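(* Let $n>1$. There is no $\phi$-recurrent generalized Sasakian-space-form $M^{2n+1}(f_1,f_2,f_3)$ of dimension $2n+1$ with $f_1-f_3\neq 0$. Explicitly: let $(M,\phi,\xi,\eta,g)$ be a $(2n+1)$-dimensional almost contact metric manifold, $n>1$, and suppose there are differentiable functions $f_1,f_2,f_3$ on $M$ such that the Riemannian curvature tensor $R$ of $g$ satisfies, for all vector fields $X,Y,Z$ on $M$, \begin{align*} R(X,Y)Z={}&f_1\{g(Y,Z)X-g(X,Z)Y\}\\ &+f_2\{g(X,\phi Z)\phi Y-g(Y,\phi Z)\phi X+2g(X,\phi Y)\phi Z\}\\ &+f_3\{\eta(X)\eta(Z)Y-\eta(Y)\eta(Z)X+g(X,Z)\eta(Y)\xi-g(Y,Z)\eta(X)\xi\}, \end{align*} where $f_1-f_3\neq 0$ at every point of $M$. Then there exists no non-zero (i.e. not identically zero) $1$-form $A$ on $M$ such that $$\phi^2\big((\nabla_W R)(X,Y)Z\big)=A(W)\,R(X,Y)Z$$ for all vector fields $X,Y,Z,W$ on $M$, where $\nabla$ is the Levi-Civita connection of $g$.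
   Context: An almost contact metric manifold $(M^{2n+1},\phi,\xi,\eta,g)$ is a smooth $(2n+1)$-dimensional manifold with a global vector field $\xi$, a $(1,1)$-tensor field $\phi$, a $1$-form $\eta$ and a Riemannian metric $g$ such that, for all vector fields $X,Y$, $$\eta(\xi)=1,\qquad \phi^2=-\mathrm{Id}+\eta\otimes\xi,\qquad g(\phi X,\phi Y)=g(X,Y)-\eta(X)\eta(Y).$$ As consequences, $\phi\xi=0$, $\eta\circ\phi=0$ and $\eta(X)=g(X,\xi)$. A generalized Sasakian-space-form $M(f_1,f_2,f_3)$ is an almost contact metric manifold for which there exist differentiable functions $f_1,f_2,f_3$ on $M$ such that $R$ has the form displayed in the claim. The manifold is called $\phi$-recurrent if there exists a non-zero $1$-form $A$ on $M$ such that $\phi^2((\nabla_WR)(X,Y)Z)=A(W)R(X,Y)Z$ for all vector fields $X,Y,Z,W$ (not necessarily orthogonal to $\xi$). The sign convention for $R$ is the one for which a space of constant sectional curvature $c$ has $R(X,Y)Z=c\{g(Y,Z)X-g(X,Z)Y\}$, i.e. $R(X,Y)Z=\nabla_X\nabla_YZ-\nabla_Y\nabla_XZ-\nabla_{[X,Y]}Z$. *)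

theory Defs
  imports "HOL-Analysis.Analysis" "HOL-Library.Function_Algebras"
begin

section \<open>Pointwise real vector space structure on functions\<close>

instantiation "fun" :: (type, real_vector) real_vector
begin

definition "scaleR_fun r f = (\<lambda>x. r *\<^sub>R f x)"

instance
  by standard (simp_all add: scaleR_fun_def fun_eq_iff algebra_simps)

end

lemma scaleR_fun_apply [simp]: "(r *\<^sub>R f) x = r *\<^sub>R f x"
  by (simp add: scaleR_fun_def)


section \<open>Smooth manifolds\<close>

text \<open>Meant for open sets \<open>S\<close>; differentiability is taken at the points of \<open>S\<close> in the
  ambient space.\<close>

primrec C_k_on ::
  "nat \<Rightarrow> ('a::euclidean_space \<Rightarrow> 'b::real_normed_vector) \<Rightarrow> 'a set \<Rightarrow> bool"
where
  "C_k_on 0 f S \<longleftrightarrow> continuous_on S f"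
| "C_k_on (Suc k) f S \<longleftrightarrow>
     (\<forall>x\<in>S. f differentiable (at x)) \<and>
     (\<forall>v. C_k_on k (\<lambda>x. frechet_derivative f (at x) v) S)"

definition smooth_on ::
  "('a::euclidean_space \<Rightarrow> 'b::real_normed_vector) \<Rightarrow> 'a set \<Rightarrow> bool" where
  "smooth_on f S \<longleftrightarrow> (\<forall>k. C_k_on k f S)"

text \<open>The manifold is the whole type \<open>'m\<close>, its dimension is \<open>DIM('e)\<close>. A chart is a pair
  consisting of its domain and the coordinate map, whose values outside the domain are
  irrelevant. Hausdorffness and second countability are left to the sort of \<open>'m\<close>.\<close>

type_synonym ('m, 'e) chart = "'m set \<times> ('m \<Rightarrow> 'e)"

definition smooth_atlas ::
  "('m::topological_space, 'e::euclidean_space) chart set \<Rightarrow> bool" where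
  "smooth_atlas \<A> \<longleftrightarrow>
     (\<Union>(U, c)\<in>\<A>. U) = UNIV \<and>
     (\<forall>(U, c)\<in>\<A>. open U \<and> open (c ` U) \<and> homeomorphism U (c ` U) c (inv_into U c)) \<and>
     (\<forall>(U, c)\<in>\<A>. \<forall>(V, d)\<in>\<A>. smooth_on (d \<circ> inv_into U c) (c ` (U \<inter> V)))"

definition smooth_fun ::
  "('m::topological_space, 'e::euclidean_space) chart set \<Rightarrow> ('m \<Rightarrow> real) \<Rightarrow> bool" where
  "smooth_fun \<A> f \<longleftrightarrow> (\<forall>(U, c)\<in>\<A>. smooth_on (f \<circ> inv_into U c) (c ` U))"

definition differentiable_fun ::
  "('m::topological_space, 'e::euclidean_space) chart set \<Rightarrow> ('m \<Rightarrow> real) \<Rightarrow> bool" where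
  "differentiable_fun \<A> f \<longleftrightarrow> (\<forall>(U, c)\<in>\<A>. (f \<circ> inv_into U c) differentiable_on (c ` U))"


section \<open>Tangent vectors and vector fields\<close>

text \<open>Tangent vectors at \<open>p\<close> are derivations at \<open>p\<close> of the algebra of smooth functions. They are
  fixed to be \<open>0\<close> on functions that are not smooth, so that equality of tangent vectors is
  equality of HOL functions.\<close>

type_synonym 'm tvec = "('m \<Rightarrow> real) \<Rightarrow> real"
type_synonym 'm vfield = "'m \<Rightarrow> 'm tvec"

definition tangent_space ::
  "('m::topological_space, 'e::euclidean_space) chart set \<Rightarrow> 'm \<Rightarrow> 'm tvec set" where
  "tangent_space \<A> p = {v.
     (\<forall>f. \<not> smooth_fun \<A> f \<longrightarrow> v f = 0) \<and>
     (\<forall>f h. smooth_fun \<A> f \<longrightarrow> smooth_fun \<A> h \<longrightarrow> v (f + h) = v f + v h) \<and>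
     (\<forall>r f. smooth_fun \<A> f \<longrightarrow> v (r *\<^sub>R f) = r * v f) \<and>
     (\<forall>f h. smooth_fun \<A> f \<longrightarrow> smooth_fun \<A> h \<longrightarrow> v (f * h) = f p * v h + h p * v f)}"

definition deriv_along :: "'m vfield \<Rightarrow> ('m \<Rightarrow> real) \<Rightarrow> 'm \<Rightarrow> real" where
  "deriv_along X f = (\<lambda>p. X p f)"

definition vector_field ::
  "('m::topological_space, 'e::euclidean_space) chart set \<Rightarrow> 'm vfield \<Rightarrow> bool" where
  "vector_field \<A> X \<longleftrightarrow>
     (\<forall>p. X p \<in> tangent_space \<A> p) \<and>
     (\<forall>f. smooth_fun \<A> f \<longrightarrow> smooth_fun \<A> (deriv_along X f))"

definition fscale :: "('m \<Rightarrow> real) \<Rightarrow> 'm vfield \<Rightarrow> 'm vfield" where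
  "fscale f X = (\<lambda>p. f p *\<^sub>R X p)"

definition lie_bracket ::
  "('m::topological_space, 'e::euclidean_space) chart set \<Rightarrow> 'm vfield \<Rightarrow> 'm vfield \<Rightarrow> 'm vfield"
where
  "lie_bracket \<A> X Y = (\<lambda>p f.
     if smooth_fun \<A> f then X p (deriv_along Y f) - Y p (deriv_along X f) else 0)"


section \<open>Tensor fields\<close>

text \<open>Tensor fields are families of (multi)linear maps on the tangent spaces; their values on
  arguments outside the tangent spaces are irrelevant. Smoothness means that evaluation at smooth
  vector fields is smooth.\<close>

definition app :: "('m \<Rightarrow> 'a \<Rightarrow> 'b) \<Rightarrow> ('m \<Rightarrow> 'a) \<Rightarrow> 'm \<Rightarrow> 'b" where
  "app T X = (\<lambda>p. T p (X p))"

definition app2 :: "('m \<Rightarrow> 'a \<Rightarrow> 'a \<Rightarrow> 'b) \<Rightarrow> ('m \<Rightarrow> 'a) \<Rightarrow> ('m \<Rightarrow> 'a) \<Rightarrow> 'm \<Rightarrow> 'b" where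
  "app2 T X Y = (\<lambda>p. T p (X p) (Y p))"

definition linear_over :: "'a::real_vector set \<Rightarrow> ('a \<Rightarrow> 'b::real_vector) \<Rightarrow> bool" where
  "linear_over S L \<longleftrightarrow>
     (\<forall>v\<in>S. \<forall>w\<in>S. L (v + w) = L v + L w) \<and> (\<forall>r. \<forall>v\<in>S. L (r *\<^sub>R v) = r *\<^sub>R L v)"

definition one_form ::
  "('m::topological_space, 'e::euclidean_space) chart set \<Rightarrow> ('m \<Rightarrow> 'm tvec \<Rightarrow> real) \<Rightarrow> bool"
where
  "one_form \<A> \<alpha> \<longleftrightarrow>
     (\<forall>p. linear_over (tangent_space \<A> p) (\<alpha> p)) \<and>
     (\<forall>X. vector_field \<A> X \<longrightarrow> smooth_fun \<A> (app \<alpha> X))"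

definition tensor_field_1_1 ::
  "('m::topological_space, 'e::euclidean_space) chart set \<Rightarrow> ('m \<Rightarrow> 'm tvec \<Rightarrow> 'm tvec) \<Rightarrow> bool"
where
  "tensor_field_1_1 \<A> \<phi> \<longleftrightarrow>
     (\<forall>p. \<phi> p ` tangent_space \<A> p \<subseteq> tangent_space \<A> p) \<and>
     (\<forall>p. linear_over (tangent_space \<A> p) (\<phi> p)) \<and>
     (\<forall>X. vector_field \<A> X \<longrightarrow> vector_field \<A> (app \<phi> X))"

definition riemannian_metric ::
  "('m::topological_space, 'e::euclidean_space) chart set
    \<Rightarrow> ('m \<Rightarrow> 'm tvec \<Rightarrow> 'm tvec \<Rightarrow> real) \<Rightarrow> bool"
where
  "riemannian_metric \<A> g \<longleftrightarrow>
     (\<forall>p. \<forall>v\<in>tangent_space \<A> p. linear_over (tangent_space \<A> p) (g p v)) \<and>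
     (\<forall>p. \<forall>v\<in>tangent_space \<A> p. \<forall>w\<in>tangent_space \<A> p. g p v w = g p w v) \<and>
     (\<forall>p. \<forall>v\<in>tangent_space \<A> p. v \<noteq> 0 \<longrightarrow> g p v v > 0) \<and>
     (\<forall>X Y. vector_field \<A> X \<longrightarrow> vector_field \<A> Y \<longrightarrow> smooth_fun \<A> (app2 g X Y))"


section \<open>Connections and curvature\<close>

definition affine_connection ::
  "('m::topological_space, 'e::euclidean_space) chart set
    \<Rightarrow> ('m vfield \<Rightarrow> 'm vfield \<Rightarrow> 'm vfield) \<Rightarrow> bool"
where
  "affine_connection \<A> D \<longleftrightarrow>
     (\<forall>X Y. vector_field \<A> X \<longrightarrow> vector_field \<A> Y \<longrightarrow> vector_field \<A> (D X Y)) \<and>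
     (\<forall>X Y Z. vector_field \<A> X \<longrightarrow> vector_field \<A> Y \<longrightarrow> vector_field \<A> Z \<longrightarrow>
        D (X + Y) Z = D X Z + D Y Z \<and> D X (Y + Z) = D X Y + D X Z) \<and>
     (\<forall>f X Y. smooth_fun \<A> f \<longrightarrow> vector_field \<A> X \<longrightarrow> vector_field \<A> Y \<longrightarrow>
        D (fscale f X) Y = fscale f (D X Y) \<and>
        D X (fscale f Y) = fscale f (D X Y) + fscale (deriv_along X f) Y)"

definition levi_civita ::
  "('m::topological_space, 'e::euclidean_space) chart set
    \<Rightarrow> ('m \<Rightarrow> 'm tvec \<Rightarrow> 'm tvec \<Rightarrow> real) \<Rightarrow> ('m vfield \<Rightarrow> 'm vfield \<Rightarrow> 'm vfield) \<Rightarrow> bool"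
where
  "levi_civita \<A> g D \<longleftrightarrow>
     affine_connection \<A> D \<and>
     (\<forall>X Y. vector_field \<A> X \<longrightarrow> vector_field \<A> Y \<longrightarrow> D X Y - D Y X = lie_bracket \<A> X Y) \<and>
     (\<forall>X Y Z. vector_field \<A> X \<longrightarrow> vector_field \<A> Y \<longrightarrow> vector_field \<A> Z \<longrightarrow>
        deriv_along X (app2 g Y Z) = app2 g (D X Y) Z + app2 g Y (D X Z))"

definition curvature ::
  "('m::topological_space, 'e::euclidean_space) chart set
    \<Rightarrow> ('m vfield \<Rightarrow> 'm vfield \<Rightarrow> 'm vfield) \<Rightarrow> 'm vfield \<Rightarrow> 'm vfield \<Rightarrow> 'm vfield \<Rightarrow> 'm vfield"
where
  "curvature \<A> D X Y Z = D X (D Y Z) - D Y (D X Z) - D (lie_bracket \<A> X Y) Z"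

text \<open>\<open>nabla_curvature \<A> D W X Y Z\<close> is $(\nabla_W R)(X,Y)Z$.\<close>

definition nabla_curvature ::
  "('m::topological_space, 'e::euclidean_space) chart set
    \<Rightarrow> ('m vfield \<Rightarrow> 'm vfield \<Rightarrow> 'm vfield)
    \<Rightarrow> 'm vfield \<Rightarrow> 'm vfield \<Rightarrow> 'm vfield \<Rightarrow> 'm vfield \<Rightarrow> 'm vfield"
where
  "nabla_curvature \<A> D W X Y Z =
     D W (curvature \<A> D X Y Z) - curvature \<A> D (D W X) Y Z
     - curvature \<A> D X (D W Y) Z - curvature \<A> D X Y (D W Z)"


section \<open>Almost contact metric manifolds\<close>

definition almost_contact_metric ::
  "('m::topological_space, 'e::euclidean_space) chart set
    \<Rightarrow> ('m \<Rightarrow> 'm tvec \<Rightarrow> 'm tvec) \<Rightarrow> 'm vfield \<Rightarrow> ('m \<Rightarrow> 'm tvec \<Rightarrow> real)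
    \<Rightarrow> ('m \<Rightarrow> 'm tvec \<Rightarrow> 'm tvec \<Rightarrow> real) \<Rightarrow> bool"
where
  "almost_contact_metric \<A> \<phi> \<xi> \<eta> g \<longleftrightarrow>
     tensor_field_1_1 \<A> \<phi> \<and> vector_field \<A> \<xi> \<and> one_form \<A> \<eta> \<and> riemannian_metric \<A> g \<and>
     app \<eta> \<xi> = 1 \<and>
     (\<forall>X. vector_field \<A> X \<longrightarrow> app \<phi> (app \<phi> X) = - X + fscale (app \<eta> X) \<xi>) \<and>
     (\<forall>X Y. vector_field \<A> X \<longrightarrow> vector_field \<A> Y \<longrightarrow>
        app2 g (app \<phi> X) (app \<phi> Y) = app2 g X Y - app \<eta> X * app \<eta> Y)"

text \<open>\<open>D\<close> is meant to be the Levi-Civita connection of \<open>g\<close>.\<close>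

definition generalized_sasakian_space_form ::
  "('m::topological_space, 'e::euclidean_space) chart set
    \<Rightarrow> ('m \<Rightarrow> 'm tvec \<Rightarrow> 'm tvec) \<Rightarrow> 'm vfield \<Rightarrow> ('m \<Rightarrow> 'm tvec \<Rightarrow> real)
    \<Rightarrow> ('m \<Rightarrow> 'm tvec \<Rightarrow> 'm tvec \<Rightarrow> real) \<Rightarrow> ('m vfield \<Rightarrow> 'm vfield \<Rightarrow> 'm vfield)
    \<Rightarrow> ('m \<Rightarrow> real) \<Rightarrow> ('m \<Rightarrow> real) \<Rightarrow> ('m \<Rightarrow> real) \<Rightarrow> bool"
where
  "generalized_sasakian_space_form \<A> \<phi> \<xi> \<eta> g D f1 f2 f3 \<longleftrightarrow>
     almost_contact_metric \<A> \<phi> \<xi> \<eta> g \<and>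
     differentiable_fun \<A> f1 \<and> differentiable_fun \<A> f2 \<and> differentiable_fun \<A> f3 \<and>
     (\<forall>X Y Z. vector_field \<A> X \<longrightarrow> vector_field \<A> Y \<longrightarrow> vector_field \<A> Z \<longrightarrow>
        curvature \<A> D X Y Z =
          fscale f1 (fscale (app2 g Y Z) X - fscale (app2 g X Z) Y)
        + fscale f2 (fscale (app2 g X (app \<phi> Z)) (app \<phi> Y)
                   - fscale (app2 g Y (app \<phi> Z)) (app \<phi> X)
                   + fscale (2 * app2 g X (app \<phi> Y)) (app \<phi> Z))
        + fscale f3 (fscale (app \<eta> X * app \<eta> Z) Y - fscale (app \<eta> Y * app \<eta> Z) X
                   + fscale (app2 g X Z * app \<eta> Y) \<xi> - fscale (app2 g Y Z * app \<eta> X) \<xi>))"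

definition phi_recurrent ::
  "('m::topological_space, 'e::euclidean_space) chart set
    \<Rightarrow> ('m \<Rightarrow> 'm tvec \<Rightarrow> 'm tvec) \<Rightarrow> ('m vfield \<Rightarrow> 'm vfield \<Rightarrow> 'm vfield) \<Rightarrow> bool"
where
  "phi_recurrent \<A> \<phi> D \<longleftrightarrow>
     (\<exists>A. one_form \<A> A \<and> (\<exists>p. \<exists>v\<in>tangent_space \<A> p. A p v \<noteq> 0) \<and>
        (\<forall>X Y Z W. vector_field \<A> X \<longrightarrow> vector_field \<A> Y \<longrightarrow> vector_field \<A> Z \<longrightarrow> vector_field \<A> W \<longrightarrow>
           app \<phi> (app \<phi> (nabla_curvature \<A> D W X Y Z)) = fscale (app A W) (curvature \<A> D X Y Z)))"

end

theory Submission
  imports Defs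
begin

text \<open>The curvature form gives $R(\xi,Y)Y = (f_1-f_3)\,g(Y,Y)\,\xi$ whenever \<open>\<eta>(Y) = 0\<close>
  (\<open>curvature_xi_contact_vector\<close>), so in this direction the curvature is purely characteristic.
  On the other hand \<open>\<eta> \<circ> \<phi> = 0\<close> (\<open>almost_contact_eta_phi\<close>), so nothing in the image of $\phi^2$ has a
  component along \<open>\<xi>\<close>. Applying \<open>\<eta>\<close> to the recurrence equation with \<open>X = \<xi>\<close> and \<open>Z = Y\<close> therefore
  leaves $0 = A(W)\,(f_1-f_3)\,g(Y,Y)$, whatever $\nabla_W R$ is. A vector \<open>Y\<close> with \<open>\<eta>(Y) = 0\<close> and
  \<open>g(Y,Y) > 0\<close> exists at each point, so \<open>A\<close> vanishes identically.

  The equations are hypotheses on global vector fields, while the conclusion concerns single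
  tangent vectors, and these are derivations of the algebra of smooth functions. Most of the work
  lies in passing between the two: every derivation at a point is the value of a
  global vector field (\<open>tangent_vector_extends\<close>), and the derivations at a point are not all
  multiples of one of them (\<open>tangent_space_not_line\<close>). Both come from cutting off the coordinate
  vector fields of a chart by a bump function; that they exhaust the derivations is Hadamard's
  lemma.\<close>

section \<open>Calculus of finitely often differentiable functions\<close>

lemma C_k_on_cong:
  assumes "open S" "\<And>x. x \<in> S \<Longrightarrow> f x = g x" "C_k_on k f S"
  shows "C_k_on k g S"
  using assms(2,3)
proof (induction k arbitrary: f g)
  case 0
  then show ?case by (simp cong: continuous_on_cong)
next
  case (Suc k)
  have der: "(g has_derivative frechet_derivative f (at x)) (at x)" if "x \<in> S" for x
    using Suc.prems that \<open>open S\<close>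
    by (auto simp: frechet_derivative_works
        intro: has_derivative_transform_within_open[where f = f])
  then have eq: "frechet_derivative g (at x) = frechet_derivative f (at x)" if "x \<in> S" for x
    using that frechet_derivative_at by metis
  have "C_k_on k (\<lambda>x. frechet_derivative g (at x) v) S" for v
    by (rule Suc.IH[of "\<lambda>x. frechet_derivative f (at x) v"]) (use Suc.prems(2) eq in auto)
  then show ?case using der unfolding C_k_on.simps differentiable_def by blast
qed

text \<open>The induction step of the rules for sums, products, compositions and integrals below. It accepts
  any formula for the derivative on \<open>S\<close>, so that the induction hypothesis can be applied to the
  formula in place of the Frechet derivative.\<close>

lemma C_k_on_SucI:
  assumes "open S" "\<And>x. x \<in> S \<Longrightarrow> (f has_derivative f' x) (at x)"
    and "\<And>v. C_k_on k (\<lambda>x. f' x v) S"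
  shows "C_k_on (Suc k) f S"
proof -
  have eq: "f' x = frechet_derivative f (at x)" if "x \<in> S" for x
    using assms(2) that frechet_derivative_at by metis
  have "C_k_on k (\<lambda>x. frechet_derivative f (at x) v) S" for v
    by (rule C_k_on_cong[OF assms(1) _ assms(3)]) (simp add: eq)
  then show ?thesis using assms(2) unfolding C_k_on.simps differentiable_def by blast
qed

lemma C_k_on_Suc_has_derivative:
  assumes "C_k_on (Suc k) f S" "x \<in> S"
  shows "(f has_derivative frechet_derivative f (at x)) (at x)"
  using assms frechet_derivative_works by auto

lemma C_k_on_subset:
  "C_k_on k f S \<Longrightarrow> T \<subseteq> S \<Longrightarrow> C_k_on k f T"
  by (induction k arbitrary: f) (auto intro: continuous_on_subset)

lemma C_k_on_SucD: "C_k_on (Suc k) f S \<Longrightarrow> C_k_on k f S"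
proof (induction k arbitrary: f)
  case 0
  then show ?case
    by (auto intro!: continuous_at_imp_continuous_on differentiable_imp_continuous_within)
qed auto

lemma C_k_on_local:
  assumes "\<And>x. x \<in> S \<Longrightarrow> \<exists>T. open T \<and> x \<in> T \<and> C_k_on k f T"
  shows "C_k_on k f S"
  using assms
proof (induction k arbitrary: f)
  case 0
  have "continuous (at x within S) f" if "x \<in> S" for x
  proof -
    obtain T where "open T" "x \<in> T" "continuous_on T f" using 0[OF \<open>x \<in> S\<close>] by auto
    then show ?thesis using continuous_at_imp_continuous_at_within continuous_on_eq_continuous_at by blast
  qed
  then show ?case by (simp add: continuous_on_eq_continuous_within)
next
  case (Suc k)
  have "C_k_on k (\<lambda>x. frechet_derivative f (at x) v) S" for v
    using Suc.prems by (intro Suc.IH) fastforce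
  then show ?case using Suc.prems by fastforce
qed

lemma C_k_on_le:
  assumes "k \<le> l" "C_k_on l f S"
  shows "C_k_on k f S"
  using assms by (induction l rule: dec_induct) (auto dest: C_k_on_SucD simp del: C_k_on.simps(2))

lemma C_k_on_const: "open S \<Longrightarrow> C_k_on k (\<lambda>x. c) S"
proof (induction k arbitrary: c)
  case (Suc k)
  then show ?case by (intro C_k_on_SucI[where f' = "\<lambda>x v. 0"]) auto
qed auto

lemma C_k_on_add:
  assumes "open S"
  shows "C_k_on k f S \<Longrightarrow> C_k_on k g S \<Longrightarrow> C_k_on k (\<lambda>x. f x + g x) S"
proof (induction k arbitrary: f g)
  case (Suc k)
  show ?case
    by (rule C_k_on_SucI[OF assms has_derivative_add[OF
          C_k_on_Suc_has_derivative[OF Suc.prems(1)] C_k_on_Suc_has_derivative[OF Suc.prems(2)]]])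
      (use Suc in auto)
qed (auto intro: continuous_intros)

lemma C_k_on_bounded_linear:
  assumes "open S" "bounded_linear L"
  shows "C_k_on k f S \<Longrightarrow> C_k_on k (\<lambda>x. L (f x)) S"
proof (induction k arbitrary: f)
  case 0
  then show ?case using assms(2) by (auto intro: bounded_linear.continuous_on)
next
  case (Suc k)
  show ?case
    by (rule C_k_on_SucI[OF assms(1) bounded_linear.has_derivative[OF assms(2)
          C_k_on_Suc_has_derivative[OF Suc.prems]]])
      (use Suc in auto)
qed

lemma C_k_on_bilinear:
  assumes "open S" "bounded_bilinear B"
  shows "C_k_on k f S \<Longrightarrow> C_k_on k g S \<Longrightarrow> C_k_on k (\<lambda>x. B (f x) (g x)) S"
proof (induction k arbitrary: f g)
  case 0
  then show ?case using assms(2) by (auto intro: bounded_bilinear.continuous_on)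
next
  case (Suc k)
  show ?case
    by (rule C_k_on_SucI[OF assms(1) bounded_bilinear.FDERIV[OF assms(2)
          C_k_on_Suc_has_derivative[OF Suc.prems(1)] C_k_on_Suc_has_derivative[OF Suc.prems(2)]]])
      (use Suc C_k_on_SucD[OF Suc.prems(1)] C_k_on_SucD[OF Suc.prems(2)] in
        \<open>auto intro!: C_k_on_add[OF assms(1)]\<close>)
qed

lemmas C_k_on_mult = C_k_on_bilinear[OF _ bounded_bilinear_mult]
lemmas C_k_on_scaleR = C_k_on_bilinear[OF _ bounded_bilinear_scaleR]

lemma C_k_on_id: "open S \<Longrightarrow> C_k_on k (\<lambda>x. x) S"
  by (cases k) (auto intro!: C_k_on_SucI[where f' = "\<lambda>x v. v"] C_k_on_const)

lemma C_k_on_sum: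
  assumes "open S" "\<And>i. i \<in> I \<Longrightarrow> C_k_on k (f i) S"
  shows "C_k_on k (\<lambda>x. \<Sum>i\<in>I. f i x) S"
  using assms(2)
proof (induction I rule: infinite_finite_induct)
  case (insert i I)
  then show ?case by (simp add: C_k_on_add[OF assms(1)])
qed (simp_all add: C_k_on_const[OF assms(1)])

text \<open>In the chain rule the direction \<open>f'(x) v\<close>, to which \<open>h'(f x)\<close> is applied, varies with \<open>x\<close>, but
  the induction hypothesis speaks about \<open>h'\<close> in fixed directions only. Expanding \<open>f'(x) v\<close> in an
  orthonormal basis separates the two.\<close>

lemma C_k_on_compose:
  fixes f :: "'a::euclidean_space \<Rightarrow> 'b::euclidean_space"
    and h :: "'b \<Rightarrow> 'c::real_normed_vector"
  assumes "open S" "open T" "f ` S \<subseteq> T"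
  shows "C_k_on k h T \<Longrightarrow> C_k_on k f S \<Longrightarrow> C_k_on k (\<lambda>x. h (f x)) S"
proof (induction k arbitrary: h)
  case 0
  then show ?case using assms(3) by (auto intro: continuous_on_compose2)
next
  case (Suc k)
  let ?f' = "\<lambda>x. frechet_derivative f (at x)" and ?h' = "\<lambda>y. frechet_derivative h (at y)"
  have h': "(h has_derivative ?h' (f x)) (at (f x))" if "x \<in> S" for x
    using C_k_on_Suc_has_derivative[OF Suc.prems(1)] assms(3) that by auto
  have der: "((\<lambda>x. h (f x)) has_derivative (\<lambda>v. ?h' (f x) (?f' x v))) (at x)" if "x \<in> S" for x
    by (rule has_derivative_compose[OF C_k_on_Suc_has_derivative[OF Suc.prems(2) that] h'[OF that]])
  have expand: "(\<Sum>i\<in>Basis. (?f' x v \<bullet> i) *\<^sub>R ?h' (f x) i) = ?h' (f x) (?f' x v)"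
    if "x \<in> S" for x v
    using linear_sum[OF has_derivative_linear[OF h'[OF that]], of "\<lambda>i. (?f' x v \<bullet> i) *\<^sub>R i" Basis]
    by (simp add: euclidean_representation linear_cmul[OF has_derivative_linear[OF h'[OF that]]])
  have "C_k_on k (\<lambda>x. \<Sum>i\<in>Basis. (?f' x v \<bullet> i) *\<^sub>R ?h' (f x) i) S" for v
    using Suc.prems(1,2) C_k_on_SucD[OF Suc.prems(2)]
    by (intro C_k_on_sum C_k_on_scaleR C_k_on_bounded_linear[OF _ bounded_linear_inner_left]
        Suc.IH assms(1)) auto
  then have "C_k_on k (\<lambda>x. ?h' (f x) (?f' x v)) S" for v
    using C_k_on_cong[OF assms(1) expand] by simp
  with der show ?case
    by (intro C_k_on_SucI[OF assms(1), where f' = "\<lambda>x v. ?h' (f x) (?f' x v)"])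
qed


section \<open>Bump functions\<close>

text \<open>The functions $t^{-n}e^{-1/t}$, extended by \<open>0\<close> to $t \le 0$. The exponent is a parameter because
  the derivative of a member is a linear combination of two other members, so all of them can be
  shown to be smooth in one induction.\<close>

definition flat_exp :: "nat \<Rightarrow> real \<Rightarrow> real" where
  "flat_exp n t = (if t > 0 then exp (- inverse t) * inverse t ^ n else 0)"

lemma flat_exp_tendsto_0: "(flat_exp n \<longlongrightarrow> 0) (at 0)"
proof -
  have "((\<lambda>t::real. exp (- inverse t) * inverse t ^ n) \<longlongrightarrow> 0) (at_right 0)"
    using filterlim_compose[OF tendsto_power_div_exp_0[of n] filterlim_inverse_at_top_right]
    by (simp add: exp_minus field_simps)
  then have "(flat_exp n \<longlongrightarrow> 0) (at_right 0)"
    by (rule Lim_transform_eventually) (auto simp: flat_exp_def eventually_at_filter)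
  moreover have "(flat_exp n \<longlongrightarrow> 0) (at_left 0)"
    by (rule tendsto_eventually) (auto simp: flat_exp_def eventually_at_filter)
  ultimately show ?thesis by (intro filterlim_split_at)
qed

lemma flat_exp_has_derivative:
  "(flat_exp n has_real_derivative (flat_exp (n + 2) t - n * flat_exp (n + 1) t)) (at t)"
proof -
  consider "t > 0" | "t < 0" | "t = 0" by linarith
  then show ?thesis
  proof cases
    case 1
    have pow: "t * t ^ (m - Suc 0) = t ^ m" if "m \<noteq> 0" for m
      using that by (cases m) auto
    have "((\<lambda>t. exp (- inverse t) * inverse t ^ n) has_real_derivative
        (flat_exp (n + 2) t - n * flat_exp (n + 1) t)) (at t)"
      using 1 by (cases n; cases "n = 1") (auto intro!: derivative_eq_intros
          simp: flat_exp_def power2_eq_square field_simps pow)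
    then show ?thesis
      by (rule has_field_derivative_transform_within_open[of _ _ _ "{0<..}"])
        (use 1 in \<open>auto simp: flat_exp_def\<close>)
  next
    case 2
    then have "((\<lambda>t. 0) has_real_derivative (flat_exp (n + 2) t - n * flat_exp (n + 1) t)) (at t)"
      by (simp add: flat_exp_def)
    then show ?thesis
      by (rule has_field_derivative_transform_within_open[of _ _ _ "{..<0}"])
        (use 2 in \<open>auto simp: flat_exp_def\<close>)
  next
    case 3
    \<comment> \<open>At the origin the difference quotient is the next member of the family.\<close>
    have "(flat_exp n h - flat_exp n 0) / h = flat_exp (n + 1) h" for h
      by (simp add: flat_exp_def divide_inverse)
    then have "(flat_exp n has_real_derivative 0) (at 0)"
      using flat_exp_tendsto_0[of "n + 1"] by (simp add: DERIV_def del: One_nat_def)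
    then show ?thesis using 3 by (simp add: flat_exp_def)
  qed
qed

lemma C_k_on_flat_exp: "C_k_on k (flat_exp n) UNIV"
proof (induction k arbitrary: n)
  case 0
  show ?case
    using flat_exp_has_derivative
    by (auto intro!: DERIV_continuous_on simp: has_field_derivative_at_within)
next
  case (Suc k)
  have "C_k_on k (\<lambda>t. (flat_exp (n + 2) t + (- n) * flat_exp (n + 1) t) * v) UNIV" for v
    by (intro C_k_on_mult C_k_on_add C_k_on_const Suc.IH) auto
  then show ?case
    by (intro C_k_on_SucI[OF _
          flat_exp_has_derivative[THEN has_field_derivative_imp_has_derivative]]) auto
qed

lemma bump_function_exists:
  fixes p :: "'a::euclidean_space"
  assumes "r > 0"
  obtains b :: "'a \<Rightarrow> real"
  where "smooth_on b UNIV" "b p = 1" "\<And>x. x \<notin> cball p r \<Longrightarrow> b x = 0"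
proof
  let ?b = "\<lambda>x. flat_exp 0 (r\<^sup>2 + (-1) * ((x + (-p)) \<bullet> (x + (-p)))) * inverse (flat_exp 0 (r\<^sup>2))"
  show "smooth_on ?b UNIV"
    unfolding smooth_on_def
    by (intro allI C_k_on_mult C_k_on_compose[OF _ _ _ C_k_on_flat_exp] C_k_on_add C_k_on_const
        C_k_on_id C_k_on_bilinear[OF _ bounded_bilinear_inner]) auto
  show "?b p = 1" using assms by (simp add: flat_exp_def)
  show "?b x = 0" if "x \<notin> cball p r" for x
  proof -
    have "r < norm (x - p)" using that by (simp add: dist_norm norm_minus_commute)
    then have "r\<^sup>2 \<le> (norm (x - p))\<^sup>2" using assms by (intro power_mono) auto
    then show ?thesis by (simp add: flat_exp_def power2_norm_eq_inner)
  qed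
qed


section \<open>Hadamard's lemma\<close>

text \<open>With \<open>m = 0\<close> and \<open>h\<close> a partial derivative of \<open>f\<close>, this is the classical smooth factor in Hadamard's
  lemma. Each differentiation under the integral sign produces one more factor \<open>t\<close>, whence the
  weight $t^m$.\<close>

definition radial_mean ::
  "'a::euclidean_space \<Rightarrow> nat \<Rightarrow> ('a \<Rightarrow> real) \<Rightarrow> 'a \<Rightarrow> real" where
  "radial_mean p m h x = integral {0..1} (\<lambda>t. t ^ m * h (p + t *\<^sub>R (x - p)))"

lemma radial_point_in_ball:
  fixes x :: "'a::euclidean_space"
  assumes "x \<in> ball p r" "t \<in> {0..1::real}"
  shows "p + t *\<^sub>R (x - p) \<in> ball p r"
proof -
  have "norm (t *\<^sub>R (x - p)) \<le> norm (x - p)"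
    using assms(2) mult_left_le_one_le[of "norm (x - p)" t] by simp
  then show ?thesis using assms(1) by (simp add: dist_norm norm_minus_commute)
qed

lemma continuous_on_radial:
  fixes h :: "'a::euclidean_space \<Rightarrow> 'b::real_normed_vector"
  assumes "continuous_on (ball p r) h"
  shows "continuous_on (ball p r \<times> {0..1::real}) (\<lambda>(x, t). h (p + t *\<^sub>R (x - p)))"
proof -
  have "continuous_on (ball p r \<times> {0..1::real}) (\<lambda>z. h (p + snd z *\<^sub>R (fst z - p)))"
    by (rule continuous_on_compose2[OF assms])
      (use radial_point_in_ball[of _ p r] in \<open>auto intro!: continuous_intros simp del: mem_ball\<close>)
  then show ?thesis by (simp add: case_prod_unfold)
qed

lemma continuous_on_radial_segment:
  fixes h :: "'a::euclidean_space \<Rightarrow> 'b::real_normed_vector"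
  assumes "continuous_on (ball p r) h" "x \<in> ball p r"
  shows "continuous_on {0..1::real} (\<lambda>t. h (p + t *\<^sub>R (x - p)))"
  by (rule continuous_on_compose2[OF assms(1)])
    (use radial_point_in_ball[OF assms(2)] in \<open>auto intro!: continuous_intros simp del: mem_ball\<close>)

lemma radial_mean_has_derivative:
  fixes h :: "'a::euclidean_space \<Rightarrow> real"
  assumes h: "C_k_on (Suc 0) h (ball p r)" and x: "x \<in> ball p r"
  shows "(radial_mean p m h has_derivative
    (\<lambda>v. radial_mean p (Suc m) (\<lambda>y. frechet_derivative h (at y) v) x)) (at x)"
proof -
  define h' where "h' y = Blinfun (frechet_derivative h (at y))" for y
  have h'_apply: "blinfun_apply (h' y) = frechet_derivative h (at y)" if "y \<in> ball p r" for y
    unfolding h'_def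
    by (rule bounded_linear_Blinfun_apply[OF has_derivative_bounded_linear[OF
          C_k_on_Suc_has_derivative[OF h that]]])
  have h'_cont: "continuous_on (ball p r) h'"
  proof (rule continuous_on_blinfun_componentwise)
    show "continuous_on (ball p r) (\<lambda>y. blinfun_apply (h' y) i)" for i
      using h h'_apply by (simp cong: continuous_on_cong del: mem_ball)
  qed
  define F where "F y t = t ^ Suc m *\<^sub>R h' (p + t *\<^sub>R (y - p))" for y t
  have F_cont: "continuous_on (ball p r \<times> {0..1}) (\<lambda>(y, t). F y t)"
    using continuous_on_radial[OF h'_cont]
    unfolding F_def case_prod_unfold by (intro continuous_intros)
  have F_seg: "continuous_on {0..1} (F x)"
    unfolding F_def by (intro continuous_intros continuous_on_radial_segment[OF h'_cont x])
  have h_cont: "continuous_on (ball p r) h" using C_k_on_SucD[OF h] by simp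
  have "((\<lambda>y. integral (cbox 0 1) (\<lambda>t. t ^ m * h (p + t *\<^sub>R (y - p)))) has_derivative
      blinfun_apply (integral (cbox 0 1) (F x))) (at x within ball p r)"
  proof (rule leibniz_rule)
    show "((\<lambda>y. t ^ m * h (p + t *\<^sub>R (y - p))) has_derivative blinfun_apply (F y t))
        (at y within ball p r)" if y: "y \<in> ball p r" and t: "t \<in> cbox 0 1" for y t
    proof -
      have z: "p + t *\<^sub>R (y - p) \<in> ball p r" using radial_point_in_ball[OF y] t by simp
      note der = C_k_on_Suc_has_derivative[OF h z]
      have "((\<lambda>y. p + t *\<^sub>R (y - p)) has_derivative (\<lambda>v. t *\<^sub>R v)) (at y)"
        by (auto intro!: derivative_eq_intros simp: algebra_simps)
      from has_derivative_mult_right[OF has_derivative_compose[OF this der], of "t ^ m"]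
      have der_t: "((\<lambda>y. t ^ m * h (p + t *\<^sub>R (y - p))) has_derivative
          (\<lambda>v. t ^ m * frechet_derivative h (at (p + t *\<^sub>R (y - p))) (t *\<^sub>R v))) (at y)" .
      have "blinfun_apply (F y t) v =
          t ^ m * frechet_derivative h (at (p + t *\<^sub>R (y - p))) (t *\<^sub>R v)" for v
        unfolding F_def linear_cmul[OF has_derivative_linear[OF der]]
        by (simp add: h'_apply[OF z] blinfun.scaleR_left)
      then have "blinfun_apply (F y t) =
          (\<lambda>v. t ^ m * frechet_derivative h (at (p + t *\<^sub>R (y - p))) (t *\<^sub>R v))" ..
      then show ?thesis using has_derivative_at_withinI[OF der_t] by simp
    qed
    show "(\<lambda>t. t ^ m * h (p + t *\<^sub>R (y - p))) integrable_on cbox 0 1" if "y \<in> ball p r" for y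
      by (intro integrable_continuous continuous_intros)
        (use continuous_on_radial_segment[OF h_cont that] in simp)
  qed (use F_cont x in auto)
  moreover have "blinfun_apply (integral (cbox 0 1) (F x)) =
      (\<lambda>v. radial_mean p (Suc m) (\<lambda>y. frechet_derivative h (at y) v) x)"
  proof
    fix v
    have "F x integrable_on cbox 0 1"
      using F_seg by (intro integrable_continuous) simp
    then have "blinfun_apply (integral (cbox 0 1) (F x)) v =
        integral (cbox 0 1) (\<lambda>t. blinfun_apply (F x t) v)"
      by (rule blinfun_apply_integral)
    also have "\<dots> = radial_mean p (Suc m) (\<lambda>y. frechet_derivative h (at y) v) x"
      unfolding radial_mean_def
      by (auto intro!: integral_cong
          simp: F_def blinfun.scaleR_left h'_apply[OF radial_point_in_ball[OF x]])
    finally show "blinfun_apply (integral (cbox 0 1) (F x)) v =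
        radial_mean p (Suc m) (\<lambda>y. frechet_derivative h (at y) v) x" .
  qed
  ultimately show ?thesis
    using x by (simp add: radial_mean_def[abs_def] at_within_open[of x "ball p r"])
qed

lemma C_k_on_radial_mean:
  "C_k_on k h (ball p r) \<Longrightarrow> C_k_on k (radial_mean p m h) (ball p r)"
proof (induction k arbitrary: h m)
  case 0
  have "continuous_on (ball p r \<times> cbox 0 1) (\<lambda>(x, t). t ^ m * h (p + t *\<^sub>R (x - p)))"
    using continuous_on_radial[of p r h] 0
    unfolding case_prod_unfold by (auto intro!: continuous_intros)
  then have "continuous_on (ball p r) (\<lambda>x. integral (cbox 0 1) (\<lambda>t. t ^ m * h (p + t *\<^sub>R (x - p))))"
    by (rule integral_continuous_on_param)
  then show ?case by (simp add: radial_mean_def[abs_def])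
next
  case (Suc k)
  have "C_k_on (Suc 0) h (ball p r)" by (rule C_k_on_le[OF _ Suc.prems]) simp
  from radial_mean_has_derivative[OF this] show ?case
    using Suc by (intro C_k_on_SucI[where
          f' = "\<lambda>x v. radial_mean p (Suc m) (\<lambda>y. frechet_derivative h (at y) v) x"]) auto
qed

lemma radial_mean_center: "radial_mean p 0 h p = h p"
  by (simp add: radial_mean_def)

text \<open>The fundamental theorem of calculus on the segment from \<open>p\<close> to \<open>x\<close>.\<close>

lemma hadamard:
  fixes f :: "'a::euclidean_space \<Rightarrow> real"
  assumes f: "C_k_on (Suc 0) f (ball p r)" and x: "x \<in> ball p r"
  shows "f x = f p + (\<Sum>i\<in>Basis. ((x - p) \<bullet> i) *
    radial_mean p 0 (\<lambda>y. frechet_derivative f (at y) i) x)"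
proof -
  let ?f' = "\<lambda>t. frechet_derivative f (at (p + t *\<^sub>R (x - p)))"
  have der: "(f has_derivative ?f' t) (at (p + t *\<^sub>R (x - p)))" if "t \<in> {0..1}" for t
    using C_k_on_Suc_has_derivative[OF f radial_point_in_ball[OF x that]] .
  have int: "(\<lambda>t. ?f' t i) integrable_on {0..1}" for i
    by (intro integrable_continuous_interval continuous_on_radial_segment[OF _ x])
      (use f in auto)
  have "((\<lambda>t. ?f' t (x - p)) has_integral f (p + 1 *\<^sub>R (x - p)) - f (p + 0 *\<^sub>R (x - p))) {0..1}"
  proof (rule fundamental_theorem_of_calculus)
    fix t :: real assume t: "t \<in> {0..1}"
    have "((\<lambda>t. p + t *\<^sub>R (x - p)) has_derivative (\<lambda>s. s *\<^sub>R (x - p))) (at t within {0..1})"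
      by (auto intro!: derivative_eq_intros)
    from has_derivative_compose[OF this der[OF t]]
    show "((\<lambda>t. f (p + t *\<^sub>R (x - p))) has_vector_derivative ?f' t (x - p)) (at t within {0..1})"
      using linear_cmul[OF has_derivative_linear[OF der[OF t]]]
      by (simp add: has_vector_derivative_def)
  qed simp
  then have "f x - f p = integral {0..1} (\<lambda>t. ?f' t (x - p))"
    by (simp add: integral_unique)
  also have "\<dots> = integral {0..1} (\<lambda>t. \<Sum>i\<in>Basis. ((x - p) \<bullet> i) * ?f' t i)"
  proof (rule integral_cong)
    fix t :: real assume t: "t \<in> {0..1}"
    note lin = has_derivative_linear[OF der[OF t]]
    show "?f' t (x - p) = (\<Sum>i\<in>Basis. ((x - p) \<bullet> i) * ?f' t i)"
      using linear_sum[OF lin, of "\<lambda>i. ((x - p) \<bullet> i) *\<^sub>R i" Basis]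
      by (simp only: euclidean_representation linear_cmul[OF lin] real_scaleR_def)
  qed
  also have "\<dots> = (\<Sum>i\<in>Basis. ((x - p) \<bullet> i) * integral {0..1} (\<lambda>t. ?f' t i))"
    by (subst integral_sum) (use int integrable_cmul in \<open>auto simp flip: real_scaleR_def\<close>)
  finally show ?thesis by (simp add: radial_mean_def)
qed


section \<open>Smooth functions on a manifold\<close>

lemma smooth_atlas_chart_open:
  assumes "smooth_atlas \<A>" "(U, c) \<in> \<A>"
  shows "open U" "open (c ` U)"
  using assms unfolding smooth_atlas_def by auto

lemma smooth_atlas_chart_homeomorphism:
  assumes "smooth_atlas \<A>" "(U, c) \<in> \<A>"
  shows "homeomorphism U (c ` U) c (inv_into U c)"
  using assms unfolding smooth_atlas_def by auto

lemma smooth_atlas_inv_into: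
  assumes "smooth_atlas \<A>" "(U, c) \<in> \<A>" "q \<in> U"
  shows "inv_into U c (c q) = q"
  using smooth_atlas_chart_homeomorphism[OF assms(1,2)] assms(3) by (auto simp: homeomorphism_def)

lemma smooth_atlas_open_image:
  assumes "smooth_atlas \<A>" "(U, c) \<in> \<A>" "open V"
  shows "open (c ` (U \<inter> V))"
proof -
  have "openin (top_of_set (c ` U)) (c ` (U \<inter> V))"
    using homeomorphism_imp_open_map[OF smooth_atlas_chart_homeomorphism[OF assms(1,2)]] assms(3)
    by (auto simp: openin_open)
  then show ?thesis
    using smooth_atlas_chart_open(2)[OF assms(1,2)] openin_open_trans by blast
qed

lemma smooth_atlas_transition:
  assumes "smooth_atlas \<A>" "(U, c) \<in> \<A>" "(V, d) \<in> \<A>"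
  shows "C_k_on k (\<lambda>y. c (inv_into V d y)) (d ` (V \<inter> U))"
  using assms unfolding smooth_atlas_def smooth_on_def o_def by fastforce

lemma smooth_funD:
  "smooth_fun \<A> f \<Longrightarrow> (U, c) \<in> \<A> \<Longrightarrow> C_k_on k (\<lambda>x. f (inv_into U c x)) (c ` U)"
  unfolding smooth_fun_def smooth_on_def o_def by fastforce

lemma smooth_funI:
  "(\<And>U c k. (U, c) \<in> \<A> \<Longrightarrow> C_k_on k (\<lambda>x. f (inv_into U c x)) (c ` U)) \<Longrightarrow> smooth_fun \<A> f"
  unfolding smooth_fun_def smooth_on_def o_def by fastforce

lemma smooth_fun_const: "smooth_atlas \<A> \<Longrightarrow> smooth_fun \<A> (\<lambda>_. a)"
  by (intro smooth_funI C_k_on_const smooth_atlas_chart_open(2))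

lemma smooth_fun_one: "smooth_atlas \<A> \<Longrightarrow> smooth_fun \<A> 1"
  unfolding one_fun_def by (rule smooth_fun_const)

lemma smooth_fun_add:
  "smooth_atlas \<A> \<Longrightarrow> smooth_fun \<A> f \<Longrightarrow> smooth_fun \<A> h \<Longrightarrow> smooth_fun \<A> (f + h)"
  unfolding plus_fun_def by (rule smooth_funI, intro C_k_on_add smooth_atlas_chart_open(2) smooth_funD)

lemma smooth_fun_mult:
  "smooth_atlas \<A> \<Longrightarrow> smooth_fun \<A> f \<Longrightarrow> smooth_fun \<A> h \<Longrightarrow> smooth_fun \<A> (f * h)"
  unfolding times_fun_def by (rule smooth_funI, intro C_k_on_mult smooth_atlas_chart_open(2) smooth_funD)

lemma smooth_fun_scaleR:
  "smooth_atlas \<A> \<Longrightarrow> smooth_fun \<A> f \<Longrightarrow> smooth_fun \<A> (r *\<^sub>R f)"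
  unfolding scaleR_fun_def
  by (rule smooth_funI, intro C_k_on_scaleR C_k_on_const smooth_atlas_chart_open(2) smooth_funD)

lemma smooth_fun_sum:
  assumes "smooth_atlas \<A>" "\<And>i. i \<in> I \<Longrightarrow> smooth_fun \<A> (f i)"
  shows "smooth_fun \<A> (\<Sum>i\<in>I. f i)"
  using assms(2)
proof (induction I rule: infinite_finite_induct)
  case (insert i I)
  then show ?case
    unfolding sum.insert[OF insert.hyps] by (intro smooth_fun_add[OF assms(1)]) auto
qed (simp_all add: zero_fun_def smooth_fun_const[OF assms(1)])

definition chart_extend :: "'m set \<Rightarrow> ('m \<Rightarrow> 'e) \<Rightarrow> ('e \<Rightarrow> real) \<Rightarrow> 'm \<Rightarrow> real" where
  "chart_extend U c h q = (if q \<in> U then h (c q) else 0)"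

text \<open>The set of points corresponding to \<open>K\<close> is compact, hence closed in the Hausdorff space \<open>'m\<close>. So
  the manifold is covered by \<open>U\<close>, where a change of charts applies, and the complement of this closed
  set, where the extension is zero.\<close>

lemma smooth_fun_chart_extend:
  fixes \<A> :: "('m::t2_space, 'e::euclidean_space) chart set"
  assumes \<A>: "smooth_atlas \<A>" and Uc: "(U, c) \<in> \<A>"
    and K: "compact K" "K \<subseteq> T" and T: "open T" "T \<subseteq> c ` U"
    and h: "\<And>k. C_k_on k h T" and h_0: "\<And>x. x \<in> c ` U \<Longrightarrow> x \<notin> K \<Longrightarrow> h x = 0"
  shows "smooth_fun \<A> (chart_extend U c h)"
proof (rule smooth_funI)
  fix V d k assume Vd: "(V, d) \<in> \<A>"
  let ?F = "\<lambda>y. chart_extend U c h (inv_into V d y)"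
  note hom = smooth_atlas_chart_homeomorphism[OF \<A> Uc]
  define C where "C = inv_into U c ` K"
  have "continuous_on K (inv_into U c)"
    using hom K(2) T(2) by (auto simp: homeomorphism_def intro: continuous_on_subset)
  then have "closed C"
    unfolding C_def using K(1) by (intro compact_imp_closed compact_continuous_image)
  have "C \<subseteq> U" unfolding C_def using K(2) T(2) by (auto intro: inv_into_into)
  have off_C: "chart_extend U c h q = 0" if "q \<notin> C" for q
    using that h_0 smooth_atlas_inv_into[OF \<A> Uc]
    by (auto simp: chart_extend_def C_def image_iff) metis
  have "C_k_on k h (c ` U)"
  proof (rule C_k_on_local)
    fix x assume x: "x \<in> c ` U"
    have "open (c ` U - K)"
      using smooth_atlas_chart_open(2)[OF \<A> Uc] K(1) by (auto intro: open_Diff compact_imp_closed)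
    moreover have "C_k_on k h (c ` U - K)"
      by (rule C_k_on_cong[OF _ _ C_k_on_const])
        (use h_0 smooth_atlas_chart_open(2)[OF \<A> Uc] K(1) in \<open>auto intro: open_Diff compact_imp_closed\<close>)
    ultimately show "\<exists>S. open S \<and> x \<in> S \<and> C_k_on k h S"
      using x T(1) h K(2) by blast
  qed
  show "C_k_on k ?F (d ` V)"
  proof (rule C_k_on_local)
    fix y assume "y \<in> d ` V"
    then obtain q where q: "q \<in> V" "y = d q" by blast
    show "\<exists>S. open S \<and> y \<in> S \<and> C_k_on k ?F S"
    proof (cases "q \<in> U")
      case True
      let ?S = "d ` (V \<inter> U)"
      have S: "open ?S" by (rule smooth_atlas_open_image[OF \<A> Vd smooth_atlas_chart_open(1)[OF \<A> Uc]])
      have "C_k_on k (\<lambda>y. h (c (inv_into V d y))) ?S"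
        by (rule C_k_on_compose[OF S smooth_atlas_chart_open(2)[OF \<A> Uc] _
              \<open>C_k_on k h (c ` U)\<close> smooth_atlas_transition[OF \<A> Uc Vd]])
          (use smooth_atlas_inv_into[OF \<A> Vd] in auto)
      then have "C_k_on k ?F ?S"
        by (rule C_k_on_cong[OF S, rotated])
          (use smooth_atlas_inv_into[OF \<A> Vd] in \<open>auto simp: chart_extend_def\<close>)
      then show ?thesis using S q True by blast
    next
      case False
      let ?S = "d ` (V \<inter> - C)"
      have S: "open ?S" using \<open>closed C\<close> by (intro smooth_atlas_open_image[OF \<A> Vd]) auto
      have "C_k_on k ?F ?S"
        by (rule C_k_on_cong[OF S _ C_k_on_const[OF S, where c = 0]])
          (use smooth_atlas_inv_into[OF \<A> Vd] off_C in auto)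
      then show ?thesis using S q False \<open>C \<subseteq> U\<close> by blast
    qed
  qed
qed


section \<open>Tangent vectors\<close>

lemma tangent_space_add:
  assumes "v \<in> tangent_space \<A> p" "w \<in> tangent_space \<A> p"
  shows "v + w \<in> tangent_space \<A> p"
  using assms unfolding tangent_space_def by (auto simp: algebra_simps)

lemma tangent_space_scaleR:
  assumes "v \<in> tangent_space \<A> p"
  shows "r *\<^sub>R v \<in> tangent_space \<A> p"
  using assms unfolding tangent_space_def by (auto simp: algebra_simps)

lemma tangent_vector_one:
  assumes "smooth_atlas \<A>" "v \<in> tangent_space \<A> p"
  shows "v 1 = 0"
proof -
  have "v (1 * 1) = 1 * v 1 + 1 * v 1"
    using assms smooth_fun_one unfolding tangent_space_def by (force simp del: mult_1_left mult_1_right)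
  then show ?thesis by simp
qed

lemma tangent_vector_sum:
  assumes "smooth_atlas \<A>" "v \<in> tangent_space \<A> p" "\<And>i. i \<in> I \<Longrightarrow> smooth_fun \<A> (f i)"
  shows "v (\<Sum>i\<in>I. f i) = (\<Sum>i\<in>I. v (f i))"
  using assms(3)
proof (induction I rule: infinite_finite_induct)
  case (insert i I)
  have "v (f i + (\<Sum>i\<in>I. f i)) = v (f i) + v (\<Sum>i\<in>I. f i)"
    using assms(2) smooth_fun_sum[OF assms(1), of I f] insert.prems
    unfolding tangent_space_def by blast
  moreover have "v (\<Sum>i\<in>I. f i) = (\<Sum>i\<in>I. v (f i))" using insert.IH insert.prems by blast
  ultimately show ?case by (simp only: sum.insert[OF insert.hyps])
next
  case empty
  have "v (0 *\<^sub>R 1) = 0 * v 1"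
    using assms(2) smooth_fun_one[OF assms(1)] unfolding tangent_space_def by blast
  then show ?case by (simp only: sum.empty scaleR_zero_left mult_zero_left)
next
  case (infinite I)
  have "v (0 *\<^sub>R 1) = 0 * v 1"
    using assms(2) smooth_fun_one[OF assms(1)] unfolding tangent_space_def by blast
  then show ?case
    by (simp only: sum.infinite[OF infinite.hyps] scaleR_zero_left mult_zero_left)
qed

lemma sum_fun_apply: "(\<Sum>i\<in>I. f i :: 'a \<Rightarrow> real) x = (\<Sum>i\<in>I. f i x)"
  by (induction I rule: infinite_finite_induct) auto

text \<open>The bump function is confined to half the radius so that a function has to be smooth only on
  the ball of radius \<open>e\<close> for its product with the bump function to extend smoothly to the manifold.
  Hadamard's lemma produces functions of this kind, as it needs a star-shaped domain.\<close>

locale bump_chart =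
  fixes \<A> :: "('m::t2_space, 'e::euclidean_space) chart set"
    and U :: "'m set" and c :: "'m \<Rightarrow> 'e" and p :: 'm and e :: real and b :: "'e \<Rightarrow> real"
  assumes atlas: "smooth_atlas \<A>" and chart: "(U, c) \<in> \<A>" and p: "p \<in> U"
    and e: "e > 0" "ball (c p) e \<subseteq> c ` U"
    and b_smooth: "smooth_on b UNIV" and b_p: "b (c p) = 1"
    and b_0: "\<And>x. x \<notin> cball (c p) (e / 2) \<Longrightarrow> b x = 0"

lemma bump_chart_exists:
  fixes \<A> :: "('m::t2_space, 'e::euclidean_space) chart set"
  assumes "smooth_atlas \<A>"
  obtains U c e b where "bump_chart \<A> U c p e b"
proof -
  have "p \<in> (\<Union>(U, c)\<in>\<A>. U)"
    using assms unfolding smooth_atlas_def by simp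
  then obtain U c where Uc: "(U, c) \<in> \<A>" "p \<in> U" by blast
  obtain e where e: "e > 0" "ball (c p) e \<subseteq> c ` U"
    using openE[OF smooth_atlas_chart_open(2)[OF assms Uc(1)], of "c p"] Uc(2) by blast
  obtain b :: "'e \<Rightarrow> real" where "smooth_on b UNIV" "b (c p) = 1" "\<And>x. x \<notin> cball (c p) (e / 2) \<Longrightarrow> b x = 0"
    using bump_function_exists[of "e / 2" "c p"] e(1) by auto
  then have "bump_chart \<A> U c p e b" using assms Uc e by (simp add: bump_chart_def)
  then show ?thesis by (rule that)
qed

context bump_chart
begin

abbreviation local_rep :: "('m \<Rightarrow> real) \<Rightarrow> 'e \<Rightarrow> real" where
  "local_rep f \<equiv> \<lambda>x. f (inv_into U c x)"

lemma cutoff_smooth: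
  assumes "\<And>k. C_k_on k h (ball (c p) e)"
  shows "smooth_fun \<A> (chart_extend U c (\<lambda>x. b x * h x))"
proof (rule smooth_fun_chart_extend[OF atlas chart compact_cball _ open_ball e(2)])
  show "C_k_on k (\<lambda>x. b x * h x) (ball (c p) e)" for k
    using assms b_smooth unfolding smooth_on_def
    by (auto intro!: C_k_on_mult intro: C_k_on_subset)
  show "cball (c p) (e / 2) \<subseteq> ball (c p) e" using e(1) by auto
qed (simp add: b_0 del: mem_cball)

text \<open>The coordinate vector field in the direction \<open>w\<close>, cut off by the bump function.\<close>

definition chart_field :: "'e \<Rightarrow> 'm vfield" where
  "chart_field w q f =
    (if smooth_fun \<A> f \<and> q \<in> U then b (c q) * frechet_derivative (local_rep f) (at (c q)) w else 0)"

lemma local_rep_has_derivative: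
  assumes "smooth_fun \<A> f" "q \<in> U"
  shows "(local_rep f has_derivative frechet_derivative (local_rep f) (at (c q))) (at (c q))"
  using C_k_on_Suc_has_derivative[OF smooth_funD[OF assms(1) chart]] assms(2) by blast

lemma chart_field_eqI:
  assumes "smooth_fun \<A> f" "q \<in> U" "(local_rep f has_derivative f') (at (c q))"
  shows "chart_field w q f = b (c q) * f' w"
  using assms frechet_derivative_at[OF assms(3)] by (simp add: chart_field_def)

lemma vector_field_chart_field: "vector_field \<A> (chart_field w)"
  unfolding vector_field_def
proof (intro conjI allI impI)
  fix q
  show "chart_field w q \<in> tangent_space \<A> q"
  proof (cases "q \<in> U")
    case True
    note d = local_rep_has_derivative[OF _ True]
    have rep: "local_rep f (c q) = f q" for f
      using smooth_atlas_inv_into[OF atlas chart True] by simp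
    have "chart_field w q (f + h) = chart_field w q f + chart_field w q h"
      if "smooth_fun \<A> f" "smooth_fun \<A> h" for f h
      using chart_field_eqI[OF smooth_fun_add[OF atlas that] True, where w = w]
        has_derivative_add[OF d[OF that(1)] d[OF that(2)]] True that
      by (simp add: chart_field_def algebra_simps)
    moreover have "chart_field w q (r *\<^sub>R f) = r * chart_field w q f"
      if "smooth_fun \<A> f" for r f
      using chart_field_eqI[OF smooth_fun_scaleR[OF atlas that] True, where w = w]
        has_derivative_scaleR_right[OF d[OF that], of r] True that
      by (simp add: chart_field_def algebra_simps)
    moreover have "chart_field w q (f * h) = f q * chart_field w q h + h q * chart_field w q f"
      if "smooth_fun \<A> f" "smooth_fun \<A> h" for f h
      using chart_field_eqI[OF smooth_fun_mult[OF atlas that] True, where w = w]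
        has_derivative_mult[OF d[OF that(1)] d[OF that(2)]] True that
      by (simp add: chart_field_def algebra_simps rep)
    ultimately show ?thesis by (simp add: tangent_space_def chart_field_def)
  next
    case False
    then show ?thesis by (simp add: tangent_space_def chart_field_def)
  qed
next
  fix f assume f: "smooth_fun \<A> f"
  have "C_k_on k (\<lambda>x. frechet_derivative (local_rep f) (at x) w) (ball (c p) e)" for k
    using smooth_funD[OF f chart, of "Suc k"] e(2) by (auto intro: C_k_on_subset)
  from cutoff_smooth[OF this]
  have "smooth_fun \<A> (chart_extend U c (\<lambda>x. b x * frechet_derivative (local_rep f) (at x) w))" .
  moreover have "deriv_along (chart_field w) f =
      chart_extend U c (\<lambda>x. b x * frechet_derivative (local_rep f) (at x) w)"
    using f by (auto simp: deriv_along_def chart_field_def chart_extend_def fun_eq_iff)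
  ultimately show "smooth_fun \<A> (deriv_along (chart_field w) f)" by simp
qed

definition coord :: "'e \<Rightarrow> 'm \<Rightarrow> real" where
  "coord i = chart_extend U c (\<lambda>x. b x * ((x + - c p) \<bullet> i))"

lemma smooth_fun_coord: "smooth_fun \<A> (coord i)"
  unfolding coord_def
  by (intro cutoff_smooth C_k_on_bounded_linear[OF _ bounded_linear_inner_left] C_k_on_add
      C_k_on_id C_k_on_const) auto

lemma coord_p: "coord i p = 0"
  by (simp add: coord_def chart_extend_def)

lemma chart_field_coord: "chart_field w p (coord i) = w \<bullet> i"
proof -
  have b: "(b has_derivative frechet_derivative b (at (c p))) (at (c p))"
    using b_smooth C_k_on_Suc_has_derivative[of 0 b UNIV] unfolding smooth_on_def by blast
  have "((\<lambda>x. (x + - c p) \<bullet> i) has_derivative (\<lambda>w. w \<bullet> i)) (at (c p))"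
    by (auto intro!: derivative_eq_intros)
  from has_derivative_mult[OF b this]
  have "((\<lambda>x. b x * ((x + - c p) \<bullet> i)) has_derivative (\<lambda>w. w \<bullet> i)) (at (c p))"
    by (simp add: b_p)
  then have "(local_rep (coord i) has_derivative (\<lambda>w. w \<bullet> i)) (at (c p))"
    by (rule has_derivative_transform_within_open[OF _ smooth_atlas_chart_open(2)[OF atlas chart]])
      (use p smooth_atlas_inv_into[OF atlas chart] in \<open>auto simp: coord_def chart_extend_def\<close>)
  then show ?thesis using chart_field_eqI[OF smooth_fun_coord p] b_p by simp
qed

text \<open>Every derivation at \<open>p\<close> is the directional derivative whose components are its values on the
  coordinates. If \<open>B\<close> denotes the extended bump function and $G_i$ the extension of \<open>b\<close> times the
  Hadamard factor of \<open>f\<close>, then Hadamard's lemma becomes the global identity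
  $B^2(f - f(p)) = \sum_i x^i G_i$, where $x^i$ are the cut-off coordinates; the square provides one
  bump factor for each of the two factors on the right. Both sides are products whose derivative at \<open>p\<close>
  can be read off, because $f - f(p)$ and all $x^i$ vanish there.\<close>

lemma tangent_vector_eq_chart_field:
  assumes v: "v \<in> tangent_space \<A> p"
  shows "v = chart_field (\<Sum>i\<in>Basis. v (coord i) *\<^sub>R i) p"
proof
  fix f
  show "v f = chart_field (\<Sum>i\<in>Basis. v (coord i) *\<^sub>R i) p f"
  proof (cases "smooth_fun \<A> f")
    case False
    then show ?thesis using v by (simp add: tangent_space_def chart_field_def)
  next
    case f: True
    let ?f' = "\<lambda>x. frechet_derivative (local_rep f) (at x)"
    have add: "v (h + k) = v h + v k" and scale: "v (r *\<^sub>R h) = r * v h"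
      and mult: "v (h * k) = h p * v k + k p * v h"
      if "smooth_fun \<A> h" "smooth_fun \<A> k" for r h k
      using v that by (auto simp: tangent_space_def)
    define G where "G i = chart_extend U c (\<lambda>x. b x * radial_mean (c p) 0 (\<lambda>y. ?f' y i) x)" for i
    define B where "B = chart_extend U c b"
    define f0 where "f0 = f + (- f p) *\<^sub>R 1"
    have f_ball: "C_k_on k (local_rep f) (ball (c p) e)" for k
      using C_k_on_subset[OF smooth_funD[OF f chart] e(2)] .
    have G: "smooth_fun \<A> (G i)" for i
      unfolding G_def using f_ball[of "Suc _"] by (intro cutoff_smooth C_k_on_radial_mean) simp
    have G_p: "G i p = ?f' (c p) i" for i
      using p by (simp add: G_def chart_extend_def b_p radial_mean_center)
    have B: "smooth_fun \<A> B"
      using cutoff_smooth[of "\<lambda>_. 1", OF C_k_on_const[OF open_ball]] by (simp add: B_def)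
    have B_p: "B p = 1" using p by (simp add: B_def chart_extend_def b_p)
    have f0: "smooth_fun \<A> f0" "f0 p = 0"
      unfolding f0_def
      by (intro smooth_fun_add[OF atlas] smooth_fun_scaleR[OF atlas] smooth_fun_one[OF atlas] f) simp
    have "(B * B * f0) q = (\<Sum>i\<in>Basis. coord i * G i) q" for q
    proof (cases "q \<in> U \<and> c q \<in> ball (c p) e")
      case True
      have "f q = f p + (\<Sum>i\<in>Basis. ((c q - c p) \<bullet> i) * radial_mean (c p) 0 (\<lambda>y. ?f' y i) (c q))"
        using hadamard[OF f_ball, of "c q"] True p smooth_atlas_inv_into[OF atlas chart] by simp
      then show ?thesis
        using True by (simp add: sum_fun_apply B_def f0_def coord_def G_def chart_extend_def
            sum_distrib_left mult_ac)
    next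
      case False
      then have "q \<notin> U \<or> b (c q) = 0" using b_0[of "c q"] e(1) by auto
      then show ?thesis by (auto simp: B_def coord_def chart_extend_def sum_fun_apply)
    qed
    then have "B * B * f0 = (\<Sum>i\<in>Basis. coord i * G i)" ..
    then have "v (B * B * f0) = (\<Sum>i\<in>Basis. v (coord i * G i))"
      by (simp only: tangent_vector_sum[OF atlas v smooth_fun_mult[OF atlas smooth_fun_coord G]])
    moreover have "v (B * B * f0) = v f"
    proof -
      have "v (B * B * f0) = v f0"
        using mult[OF smooth_fun_mult[OF atlas B B] f0(1)] B_p f0(2) by simp
      also have "\<dots> = v f"
        unfolding f0_def
        by (simp only: add[OF f smooth_fun_scaleR[OF atlas smooth_fun_one[OF atlas]]]
            scale[OF smooth_fun_one[OF atlas] f] tangent_vector_one[OF atlas v]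
            mult_zero_right add_0_right)
      finally show ?thesis .
    qed
    moreover have "v (coord i * G i) = v (coord i) * ?f' (c p) i" for i
      using mult[OF smooth_fun_coord G] coord_p G_p by simp
    moreover have "chart_field (\<Sum>i\<in>Basis. v (coord i) *\<^sub>R i) p f =
        (\<Sum>i\<in>Basis. v (coord i) * ?f' (c p) i)"
      using has_derivative_linear[OF local_rep_has_derivative[OF f p]] f p
      by (simp add: chart_field_def b_p linear_sum linear_cmul)
    ultimately show ?thesis by simp
  qed
qed

end

lemma tangent_vector_extends:
  fixes \<A> :: "('m::t2_space, 'e::euclidean_space) chart set"
  assumes "smooth_atlas \<A>" "v \<in> tangent_space \<A> p"
  obtains X where "vector_field \<A> X" "X p = v"
proof -
  obtain U c e b where "bump_chart \<A> U c p e b" using bump_chart_exists[OF assms(1)] .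
  then interpret bump_chart \<A> U c p e b .
  show ?thesis
    using that vector_field_chart_field tangent_vector_eq_chart_field[OF assms(2)] by metis
qed

text \<open>Two coordinate fields in orthogonal directions cannot both be multiples of \<open>u\<close> at \<open>p\<close>, because
  the coordinate functions tell them apart.\<close>

lemma tangent_space_not_line:
  fixes \<A> :: "('m::t2_space, 'e::euclidean_space) chart set"
  assumes "smooth_atlas \<A>" "DIM('e) \<ge> 2"
  obtains v where "v \<in> tangent_space \<A> p" "\<And>a. v \<noteq> a *\<^sub>R u"
proof (rule ccontr)
  assume neg: "\<not> thesis"
  obtain U c e b where "bump_chart \<A> U c p e b" using bump_chart_exists[OF assms(1)] .
  then interpret bump_chart \<A> U c p e b .
  have "chart_field w p \<in> tangent_space \<A> p" for w
    using vector_field_chart_field by (simp add: vector_field_def)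
  then have "\<exists>a. chart_field w p = a *\<^sub>R u" for w using neg that by blast
  then obtain a where a: "\<And>w. chart_field w p = a w *\<^sub>R u" by metis
  obtain i j :: 'e where ij: "i \<in> Basis" "j \<in> Basis" "i \<noteq> j"
    using assms(2) by (metis card_le_Suc0_iff_eq finite_Basis not_less_eq_eq numeral_2_eq_2)
  have "a w * u (coord k) = w \<bullet> k" for w k
    using chart_field_coord[of w k] a[of w] by simp
  from this[of i i] this[of i j] this[of j j] ij show False by (auto simp: inner_Basis)
qed


section \<open>Vector fields\<close>

lemma vector_field_in_tangent_space: "vector_field \<A> X \<Longrightarrow> X p \<in> tangent_space \<A> p"
  unfolding vector_field_def by blast

lemma vector_field_add:
  assumes "smooth_atlas \<A>" "vector_field \<A> X" "vector_field \<A> Y"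
  shows "vector_field \<A> (X + Y)"
proof -
  have "deriv_along (X + Y) f = deriv_along X f + deriv_along Y f" for f
    by (simp add: deriv_along_def fun_eq_iff)
  then show ?thesis
    using assms unfolding vector_field_def by (auto intro!: tangent_space_add smooth_fun_add)
qed

lemma vector_field_fscale:
  assumes "smooth_atlas \<A>" "smooth_fun \<A> h" "vector_field \<A> X"
  shows "vector_field \<A> (fscale h X)"
proof -
  have "deriv_along (fscale h X) f = h * deriv_along X f" for f
    by (simp add: deriv_along_def fscale_def fun_eq_iff)
  then show ?thesis
    using assms unfolding vector_field_def
    by (auto intro!: tangent_space_scaleR smooth_fun_mult simp: fscale_def)
qed

lemma vector_field_diff:
  assumes "smooth_atlas \<A>" "vector_field \<A> X" "vector_field \<A> Y"
  shows "vector_field \<A> (X - Y)"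
proof -
  have "X - Y = X + fscale (\<lambda>_. - 1) Y" by (simp add: fscale_def fun_eq_iff)
  then show ?thesis using assms by (simp only: vector_field_add vector_field_fscale smooth_fun_const)
qed

text \<open>That the Lie bracket of vector fields is a vector field follows here from the vanishing of the
  torsion.\<close>

lemma vector_field_curvature:
  assumes "smooth_atlas \<A>" "levi_civita \<A> g D"
    and "vector_field \<A> X" "vector_field \<A> Y" "vector_field \<A> Z"
  shows "vector_field \<A> (curvature \<A> D X Y Z)"
proof -
  have D: "vector_field \<A> (D V W)" if "vector_field \<A> V" "vector_field \<A> W" for V W
    using assms(2) that unfolding levi_civita_def affine_connection_def by blast
  have "lie_bracket \<A> X Y = D X Y - D Y X"
    using assms(2,3,4) unfolding levi_civita_def by metis
  then show ?thesis
    unfolding curvature_def using assms by (simp only: vector_field_diff D)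
qed

lemma vector_field_nabla_curvature:
  assumes "smooth_atlas \<A>" "levi_civita \<A> g D"
    and "vector_field \<A> X" "vector_field \<A> Y" "vector_field \<A> Z" "vector_field \<A> W"
  shows "vector_field \<A> (nabla_curvature \<A> D W X Y Z)"
proof -
  have D: "vector_field \<A> (D V W)" if "vector_field \<A> V" "vector_field \<A> W" for V W
    using assms(2) that unfolding levi_civita_def affine_connection_def by blast
  show ?thesis
    unfolding nabla_curvature_def
    by (intro vector_field_diff D vector_field_curvature[OF assms(1,2)] assms)
qed


section \<open>Almost contact metric structures at a point\<close>

lemma
  assumes "almost_contact_metric \<A> \<phi> \<xi> \<eta> g"
  shows almost_contact_vector_field_xi: "vector_field \<A> \<xi>"
    and almost_contact_eta_linear: "linear_over (tangent_space \<A> p) (\<eta> p)"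
    and almost_contact_phi_linear: "linear_over (tangent_space \<A> p) (\<phi> p)"
    and almost_contact_phi_in_tangent_space:
      "v \<in> tangent_space \<A> p \<Longrightarrow> \<phi> p v \<in> tangent_space \<A> p"
    and almost_contact_eta_xi: "\<eta> p (\<xi> p) = 1"
proof -
  show "vector_field \<A> \<xi>" "linear_over (tangent_space \<A> p) (\<eta> p)"
    "linear_over (tangent_space \<A> p) (\<phi> p)"
    using assms unfolding almost_contact_metric_def one_form_def tensor_field_1_1_def by blast+
  show "\<phi> p v \<in> tangent_space \<A> p" if "v \<in> tangent_space \<A> p"
    using assms that unfolding almost_contact_metric_def tensor_field_1_1_def by blast
  have "app \<eta> \<xi> p = 1" using assms unfolding almost_contact_metric_def by simp
  then show "\<eta> p (\<xi> p) = 1" by (simp add: app_def)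
qed

lemma almost_contact_metric_at_point:
  fixes \<A> :: "('m::t2_space, 'e::euclidean_space) chart set"
  assumes atlas: "smooth_atlas \<A>" and acm: "almost_contact_metric \<A> \<phi> \<xi> \<eta> g"
  shows "v \<in> tangent_space \<A> p \<Longrightarrow> \<phi> p (\<phi> p v) = - v + \<eta> p v *\<^sub>R \<xi> p"
    and "v \<in> tangent_space \<A> p \<Longrightarrow> w \<in> tangent_space \<A> p \<Longrightarrow>
      g p (\<phi> p v) (\<phi> p w) = g p v w - \<eta> p v * \<eta> p w"
proof -
  show "\<phi> p (\<phi> p v) = - v + \<eta> p v *\<^sub>R \<xi> p" if v: "v \<in> tangent_space \<A> p"
  proof -
    obtain X where X: "vector_field \<A> X" "X p = v" using tangent_vector_extends[OF atlas v] .
    have "app \<phi> (app \<phi> X) p = (- X + fscale (app \<eta> X) \<xi>) p"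
      using acm X(1) unfolding almost_contact_metric_def by metis
    then show ?thesis using X(2) by (simp add: app_def fscale_def)
  qed
  show "g p (\<phi> p v) (\<phi> p w) = g p v w - \<eta> p v * \<eta> p w"
    if v: "v \<in> tangent_space \<A> p" and w: "w \<in> tangent_space \<A> p"
  proof -
    obtain X where X: "vector_field \<A> X" "X p = v" using tangent_vector_extends[OF atlas v] .
    obtain Y where Y: "vector_field \<A> Y" "Y p = w" using tangent_vector_extends[OF atlas w] .
    have "app2 g (app \<phi> X) (app \<phi> Y) p = (app2 g X Y - app \<eta> X * app \<eta> Y) p"
      using acm X(1) Y(1) unfolding almost_contact_metric_def by metis
    then show ?thesis using X(2) Y(2) by (simp add: app_def app2_def)
  qed
qed

text \<open>The argument for \<open>\<phi> \<xi> = 0\<close>: since $\phi^2\xi = 0$, the formula for $\phi^2$ at \<open>\<phi> \<xi>\<close> says that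
  \<open>\<phi> \<xi> = a \<xi>\<close> with \<open>a = \<eta>(\<phi> \<xi>)\<close>; then $0 = \phi^2\xi = a^2\xi$. The second claim compares the two ways
  of evaluating $\phi^3 v$, and the third is the compatibility of \<open>g\<close> with \<open>\<phi>\<close> at the pair \<open>v\<close>, \<open>\<xi>\<close>.\<close>

lemma
  fixes \<A> :: "('m::t2_space, 'e::euclidean_space) chart set"
  assumes atlas: "smooth_atlas \<A>" and acm: "almost_contact_metric \<A> \<phi> \<xi> \<eta> g"
  shows almost_contact_phi_xi: "\<phi> p (\<xi> p) = 0"
    and almost_contact_eta_phi: "v \<in> tangent_space \<A> p \<Longrightarrow> \<eta> p (\<phi> p v) = 0"
    and almost_contact_metric_xi: "v \<in> tangent_space \<A> p \<Longrightarrow> g p v (\<xi> p) = \<eta> p v"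
proof -
  let ?T = "tangent_space \<A> p"
  note sq = almost_contact_metric_at_point(1)[OF atlas acm]
    and gphi = almost_contact_metric_at_point(2)[OF atlas acm]
  note phi_T = almost_contact_phi_in_tangent_space[OF acm]
    and phi_lin = almost_contact_phi_linear[OF acm, of p]
    and eta_lin = almost_contact_eta_linear[OF acm, of p]
    and xi = vector_field_in_tangent_space[OF almost_contact_vector_field_xi[OF acm], of p]
  have g_lin: "linear_over ?T (g p v)" if "v \<in> ?T" for v
    using acm that unfolding almost_contact_metric_def riemannian_metric_def by blast
  have lin_scale: "L (r *\<^sub>R v) = r *\<^sub>R L v" if "linear_over ?T L" "v \<in> ?T"
    for L :: "'m tvec \<Rightarrow> 'z::real_vector" and r v
    using that unfolding linear_over_def by blast
  have lin_add: "L (v + w) = L v + L w" if "linear_over ?T L" "v \<in> ?T" "w \<in> ?T"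
    for L :: "'m tvec \<Rightarrow> 'z::real_vector" and v w
    using that unfolding linear_over_def by blast
  have lin_0: "L 0 = 0" if "linear_over ?T L" for L :: "'m tvec \<Rightarrow> 'z::real_vector"
    using lin_scale[OF that xi, of 0] by simp
  note eta_xi = almost_contact_eta_xi[OF acm, of p]
  have xi_nz: "\<xi> p \<noteq> 0" using eta_xi lin_0[OF eta_lin] by auto
  have sq_xi: "\<phi> p (\<phi> p (\<xi> p)) = 0" using sq[OF xi] eta_xi by simp
  show phi_xi: "\<phi> p (\<xi> p) = 0"
  proof -
    let ?a = "\<eta> p (\<phi> p (\<xi> p))"
    have "\<phi> p (\<phi> p (\<phi> p (\<xi> p))) = 0" using sq_xi lin_0[OF phi_lin] by simp
    then have a: "\<phi> p (\<xi> p) = ?a *\<^sub>R \<xi> p" using sq[OF phi_T[OF xi]] by simp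
    have "(?a * ?a) *\<^sub>R \<xi> p = \<phi> p (?a *\<^sub>R \<xi> p)"
      using lin_scale[OF phi_lin xi, of ?a] a by (metis scaleR_scaleR)
    also have "\<dots> = 0" using sq_xi a by simp
    finally have "?a = 0" using xi_nz by simp
    then show ?thesis using a by simp
  qed
  show "\<eta> p (\<phi> p v) = 0" if v: "v \<in> ?T"
  proof -
    have mv: "- v \<in> ?T" using tangent_space_scaleR[OF v, of "- 1"] by simp
    have "\<phi> p (\<phi> p (\<phi> p v)) = \<phi> p (- v) + \<phi> p (\<eta> p v *\<^sub>R \<xi> p)"
      unfolding sq[OF v] by (rule lin_add[OF phi_lin mv tangent_space_scaleR[OF xi]])
    also have "\<dots> = - \<phi> p v"
      using lin_scale[OF phi_lin v, of "- 1"] lin_scale[OF phi_lin xi] phi_xi by simp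
    finally have "\<eta> p (\<phi> p v) *\<^sub>R \<xi> p = 0" using sq[OF phi_T[OF v]] by simp
    then show ?thesis using xi_nz by simp
  qed
  show "g p v (\<xi> p) = \<eta> p v" if v: "v \<in> ?T"
    using gphi[OF v xi] lin_0[OF g_lin[OF phi_T[OF v]]] phi_xi eta_xi by simp
qed

text \<open>Subtract from a vector that is not a multiple of \<open>\<xi>\<close> its component along \<open>\<xi>\<close>.\<close>

lemma contact_vector_exists:
  fixes \<A> :: "('m::t2_space, 'e::euclidean_space) chart set"
  assumes atlas: "smooth_atlas \<A>" and acm: "almost_contact_metric \<A> \<phi> \<xi> \<eta> g"
    and dim: "DIM('e) \<ge> 2"
  obtains v where "v \<in> tangent_space \<A> p" "\<eta> p v = 0" "g p v v > 0"
proof -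
  obtain w where w: "w \<in> tangent_space \<A> p" "\<And>a. w \<noteq> a *\<^sub>R \<xi> p"
    using tangent_space_not_line[OF atlas dim] by metis
  note xi = vector_field_in_tangent_space[OF almost_contact_vector_field_xi[OF acm], of p]
  define v where "v = w + (- \<eta> p w) *\<^sub>R \<xi> p"
  have v: "v \<in> tangent_space \<A> p"
    unfolding v_def by (intro tangent_space_add tangent_space_scaleR w xi)
  note eta_xi = almost_contact_eta_xi[OF acm, of p]
  have "\<eta> p v = \<eta> p w + (- \<eta> p w) *\<^sub>R \<eta> p (\<xi> p)"
    using almost_contact_eta_linear[OF acm, of p] w(1) xi tangent_space_scaleR[OF xi]
    unfolding v_def linear_over_def by metis
  then have "\<eta> p v = 0" using eta_xi by simp
  moreover have "v \<noteq> 0" using w(2)[of "\<eta> p w"] by (auto simp: v_def)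
  then have "g p v v > 0"
    using acm v unfolding almost_contact_metric_def riemannian_metric_def by blast
  ultimately show ?thesis using that v by blast
qed


section \<open>The characteristic component of the curvature\<close>

text \<open>The \<open>f2\<close> part drops out since each of its terms contains \<open>\<phi> \<xi> = 0\<close> or \<open>g(\<xi>, \<phi> Y) = \<eta>(\<phi> Y) = 0\<close>.
  Of the other two parts only the terms with \<open>g(Y, Y)\<close> survive, and both point along \<open>\<xi>\<close>.\<close>

lemma curvature_xi_contact_vector:
  fixes \<A> :: "('m::t2_space, 'e::euclidean_space) chart set"
  assumes atlas: "smooth_atlas \<A>"
    and gssf: "generalized_sasakian_space_form \<A> \<phi> \<xi> \<eta> g D f1 f2 f3"
    and Y: "vector_field \<A> Y" "\<eta> p (Y p) = 0"
  shows "curvature \<A> D \<xi> Y Y p = ((f1 p - f3 p) * g p (Y p) (Y p)) *\<^sub>R \<xi> p"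
proof -
  have acm: "almost_contact_metric \<A> \<phi> \<xi> \<eta> g"
    using gssf unfolding generalized_sasakian_space_form_def by blast
  note xi = almost_contact_vector_field_xi[OF acm]
  have T: "Y p \<in> tangent_space \<A> p" "\<xi> p \<in> tangent_space \<A> p" "\<phi> p (Y p) \<in> tangent_space \<A> p"
    using Y(1) xi almost_contact_phi_in_tangent_space[OF acm]
    by (simp_all add: vector_field_in_tangent_space)
  have sym: "g p v w = g p w v" if "v \<in> tangent_space \<A> p" "w \<in> tangent_space \<A> p" for v w
    using acm that unfolding almost_contact_metric_def riemannian_metric_def by blast
  note eta_xi = almost_contact_eta_xi[OF acm, of p]
  have g_xi: "g p (\<xi> p) (Y p) = 0" "g p (\<xi> p) (\<phi> p (Y p)) = 0"
    using almost_contact_metric_xi[OF atlas acm] almost_contact_eta_phi[OF atlas acm] T Y(2)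
      sym[OF T(2)] by auto
  have "curvature \<A> D \<xi> Y Y p =
      (fscale f1 (fscale (app2 g Y Y) \<xi> - fscale (app2 g \<xi> Y) Y)
        + fscale f2 (fscale (app2 g \<xi> (app \<phi> Y)) (app \<phi> Y)
                   - fscale (app2 g Y (app \<phi> Y)) (app \<phi> \<xi>)
                   + fscale (2 * app2 g \<xi> (app \<phi> Y)) (app \<phi> Y))
        + fscale f3 (fscale (app \<eta> \<xi> * app \<eta> Y) Y - fscale (app \<eta> Y * app \<eta> Y) \<xi>
                   + fscale (app2 g \<xi> Y * app \<eta> Y) \<xi> - fscale (app2 g Y Y * app \<eta> \<xi>) \<xi>)) p"
    using gssf xi Y(1) by (simp only: generalized_sasakian_space_form_def)
  then show ?thesis
    using almost_contact_phi_xi[OF atlas acm, of p]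
    by (simp add: fscale_def app_def app2_def g_xi Y(2) eta_xi scaleR_diff_left algebra_simps)
qed

theorem theorem3p1:
  fixes \<A> :: "('m::{t2_space, second_countable_topology}, 'e::euclidean_space) chart set"
    and \<phi> :: "'m \<Rightarrow> 'm tvec \<Rightarrow> 'm tvec"
    and \<xi> :: "'m vfield"
    and \<eta> :: "'m \<Rightarrow> 'm tvec \<Rightarrow> real"
    and g :: "'m \<Rightarrow> 'm tvec \<Rightarrow> 'm tvec \<Rightarrow> real"
    and D :: "'m vfield \<Rightarrow> 'm vfield \<Rightarrow> 'm vfield"
    and f1 f2 f3 :: "'m \<Rightarrow> real"
    and n :: nat
  assumes "n > 1"
    and "DIM('e) = 2 * n + 1"
    and "smooth_atlas \<A>"
    and "levi_civita \<A> g D"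
    and "generalized_sasakian_space_form \<A> \<phi> \<xi> \<eta> g D f1 f2 f3"
    and "\<And>p. f1 p - f3 p \<noteq> 0"
  shows "\<not> phi_recurrent \<A> \<phi> D"
proof
  note atlas = \<open>smooth_atlas \<A>\<close>
  assume "phi_recurrent \<A> \<phi> D"
  then obtain A p w where w: "w \<in> tangent_space \<A> p" "A p w \<noteq> 0"
    and rec: "\<And>X Y Z W. vector_field \<A> X \<Longrightarrow> vector_field \<A> Y \<Longrightarrow> vector_field \<A> Z \<Longrightarrow>
      vector_field \<A> W \<Longrightarrow>
      app \<phi> (app \<phi> (nabla_curvature \<A> D W X Y Z)) = fscale (app A W) (curvature \<A> D X Y Z)"
    unfolding phi_recurrent_def by blast
  have acm: "almost_contact_metric \<A> \<phi> \<xi> \<eta> g"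
    using assms(5) unfolding generalized_sasakian_space_form_def by blast
  note xi = almost_contact_vector_field_xi[OF acm]
  obtain y where y: "y \<in> tangent_space \<A> p" "\<eta> p y = 0" "g p y y > 0"
    using contact_vector_exists[OF atlas acm] assms(1,2) by auto
  obtain Y where Y: "vector_field \<A> Y" "Y p = y" using tangent_vector_extends[OF atlas y(1)] .
  obtain W where W: "vector_field \<A> W" "W p = w" using tangent_vector_extends[OF atlas w(1)] .
  define r where "r = A p w * ((f1 p - f3 p) * g p y y)"
  define u where "u = nabla_curvature \<A> D W \<xi> Y Y p"
  have "vector_field \<A> (nabla_curvature \<A> D W \<xi> Y Y)"
    by (rule vector_field_nabla_curvature[OF atlas assms(4) xi Y(1) Y(1) W(1)])
  then have "u \<in> tangent_space \<A> p" unfolding u_def by (rule vector_field_in_tangent_space)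
  then have "\<phi> p u \<in> tangent_space \<A> p" by (rule almost_contact_phi_in_tangent_space[OF acm])
  then have "\<eta> p (\<phi> p (\<phi> p u)) = 0" by (rule almost_contact_eta_phi[OF atlas acm])
  moreover have "\<phi> p (\<phi> p u) = r *\<^sub>R \<xi> p"
  proof -
    have "\<phi> p (\<phi> p u) = A p w *\<^sub>R curvature \<A> D \<xi> Y Y p"
      using fun_cong[OF rec[OF xi Y(1) Y(1) W(1)], of p] W(2)
      by (simp add: app_def fscale_def u_def)
    then show ?thesis
      using curvature_xi_contact_vector[OF atlas assms(5) Y(1), of p] Y(2) y(2)
      by (simp add: r_def)
  qed
  moreover have "\<eta> p (r *\<^sub>R \<xi> p) = r * \<eta> p (\<xi> p)"
    using almost_contact_eta_linear[OF acm] vector_field_in_tangent_space[OF xi]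
    by (simp add: linear_over_def)
  moreover have "\<eta> p (\<xi> p) = 1" by (rule almost_contact_eta_xi[OF acm])
  ultimately have "r = 0" by simp
  then show False using w(2) assms(6)[of p] y(3) by (simp add: r_def)
qed

end
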